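(* Let $\mathcal{D}=(d_n)_{n=1}^\infty$ be a bounded sequence of integers with $d_n\ge 2$ for all $n$, and let $i,j$ be real numbers with $0<i,j<1$ and $i+j=1$. Then the set $$\mathbf{Bad}_{\mathcal{D}}(i,j)=\Big\{x\in\mathbb{R} : \exists\, c(x)>0 \text{ such that } \max\{|q|_{\mathcal{D}}^{1/i},\ \|qx\|^{1/j}\}>\frac{c(x)}{q}\quad \forall\, q\in\mathbb{N}\Big\}$$ is $1/4$-winning (in the sense of Schmidt games on $\mathbb{R}$).
   Context: Here $\mathbb{N}=\{1,2,3,\dots\}$ and $\|y\|$ denotes the distance from $y\in\mathbb{R}$ to the nearest integer. The $\mathcal{D}$-norm: for a bounded sequence $\mathcal{D}=(d_n)_{n=1}^\infty$ of integers $d_n\ge 2$, put $D_0:=1$ and $D_n:=\prod_{k=1}^n d_k$ for $n\ge1$. For $q\in\mathbb{N}$ let $\omega_{\mathcal{D}}(q):=\sup\{n\ge 0 : q\in D_n\mathbb{Z}\}$ and $|q|_{\mathcal{D}}:=1/D_{\omega_{\mathcal{D}}(q)}=\inf\{1/D_n : n\ge 0,\ q\in D_n\mathbb{Z}\}$. Schmidt games on $\mathbb{R}$: let $0<\alpha<1$ and $0<\beta<1$. Two players A and B play as follows. First, B chooses a closed interval $B_1\subset\mathbb{R}$ (bounded, of positive length). Next, A chooses a closed interval $A_1\subset B_1$ of length $\alpha|B_1|$. Then B chooses a closed interval $B_2\subset A_1$ of length $\beta|A_1|$, and so on alternately, generating a nested sequence of closed intervals $B_1\supset A_1\supset B_2\supset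 A_2\supset\cdots$ with $|B_m|=(\alpha\beta)^{m-1}|B_1|$ and $|A_m|=\alpha|B_m|$. A set $S\subset\mathbb{R}$ is $(\alpha,\beta)$-winning if A can play in such a way that the unique point of $\bigcap_{m\ge1}B_m=\bigcap_{m\ge1}A_m$ lies in $S$, regardless of how B plays. The set $S$ is $\alpha$-winning if it is $(\alpha,\beta)$-winning for all $\beta\in(0,1)$. *)

theory Defs
  imports "HOL-Analysis.Analysis"
begin

definition dist_int :: "real \<Rightarrow> real" where
  "dist_int y = \<bar>y - of_int (round y)\<bar>"

(* The sequence is indexed from 1; the value d 0 is never used. *)
definition D_prod :: "(nat \<Rightarrow> nat) \<Rightarrow> nat \<Rightarrow> nat" where
  "D_prod d n = (\<Prod>k=1..n. d k)"

(* For q \<ge> 1 and all d k \<ge> 2 the set is finite and contains 0, so Sup is its maximum. *)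
definition D_order :: "(nat \<Rightarrow> nat) \<Rightarrow> nat \<Rightarrow> nat" where
  "D_order d q = Sup {n. D_prod d n dvd q}"

definition D_norm :: "(nat \<Rightarrow> nat) \<Rightarrow> nat \<Rightarrow> real" where
  "D_norm d q = 1 / real (D_prod d (D_order d q))"

definition Bad_D :: "(nat \<Rightarrow> nat) \<Rightarrow> real \<Rightarrow> real \<Rightarrow> real set" where
  "Bad_D d i j = {x. \<exists>c>0. \<forall>q\<ge>1.
     max (D_norm d q powr (1 / i)) (dist_int (real q * x) powr (1 / j)) > c / real q}"

definition closed_interval :: "real set \<Rightarrow> bool" where
  "closed_interval I \<longleftrightarrow> (\<exists>a b. a < b \<and> I = {a..b})"

definition legal_move :: "real \<Rightarrow> real set \<Rightarrow> real set \<Rightarrow> bool" where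
  "legal_move r I J \<longleftrightarrow>
     closed_interval J \<and> J \<subseteq> I \<and> measure lborel J = r * measure lborel I"

(* A strategy for A maps the list of the intervals B has played so far (the last one
   most recent) to A's reply. A's own earlier moves are determined by this list.
   Replies are required to be legal after every list ending in a closed interval,
   so A cannot win by making B unable to continue. *)
definition strategy :: "real \<Rightarrow> (real set list \<Rightarrow> real set) \<Rightarrow> bool" where
  "strategy \<alpha> \<sigma> \<longleftrightarrow>
     (\<forall>Bs. Bs \<noteq> [] \<longrightarrow> closed_interval (last Bs) \<longrightarrow> legal_move \<alpha> (last Bs) (\<sigma> Bs))"

(* The intervals of B are numbered from 0 here: B m is the (m+1)-st one. *)
definition reply :: "(real set list \<Rightarrow> real set) \<Rightarrow> (nat \<Rightarrow> real set) \<Rightarrow> nat \<Rightarrow> real set" where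
  "reply \<sigma> B m = \<sigma> (map B [0..<Suc m])"

definition play_against :: "real \<Rightarrow> (real set list \<Rightarrow> real set) \<Rightarrow> (nat \<Rightarrow> real set) \<Rightarrow> bool" where
  "play_against \<beta> \<sigma> B \<longleftrightarrow>
     closed_interval (B 0) \<and> (\<forall>m. legal_move \<beta> (reply \<sigma> B m) (B (Suc m)))"

definition winning2 :: "real \<Rightarrow> real \<Rightarrow> real set \<Rightarrow> bool" where
  "winning2 \<alpha> \<beta> S \<longleftrightarrow>
     (\<exists>\<sigma>. strategy \<alpha> \<sigma> \<and> (\<forall>B. play_against \<beta> \<sigma> B \<longrightarrow> (\<exists>x\<in>S. (\<Inter>m. B m) = {x})))"

definition winning :: "real \<Rightarrow> real set \<Rightarrow> bool" where
  "winning \<alpha> S \<longleftrightarrow> (\<forall>\<beta>. 0 < \<beta> \<and> \<beta> < 1 \<longrightarrow> winning2 \<alpha> \<beta> S)"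

end

theory Submission
  imports Defs
begin

text \<open>
  If \<open>x\<close> violates the defining inequality at \<open>q\<close> with constant \<open>c\<close>, then \<open>x\<close> is within
  \<open>c\<^sup>j q\<^sup>-\<^sup>1\<^sup>-\<^sup>j\<close> of some \<open>p/q\<close>, where \<open>q\<close> is divisible by some \<open>D\<^sub>n \<ge> (q/c)\<^sup>i\<close>. As the \<open>D\<^sub>n\<close> form a chain
  under divisibility, two distinct such fractions with denominators \<open>q\<^sub>1 \<le> q\<^sub>2\<close> have a common
  divisor \<open>D\<^sub>n \<ge> (q\<^sub>1/c)\<^sup>i\<close> of their denominators, so they are at distance at least
  \<open>D\<^sub>n/(q\<^sub>1q\<^sub>2) \<ge> c\<^sup>-\<^sup>i q\<^sub>2\<^sup>-\<^sup>1\<^sup>-\<^sup>j\<close>. Put \<open>R = 4/\<beta>\<close>, so that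
  \<open>|B\<^sub>m| = |B\<^sub>0| R\<^sup>-\<^sup>m\<close>, and let player A deal at move \<open>m\<close> with the \<open>q\<close> such that
  \<open>R\<^sup>m \<le> q\<^sup>1\<^sup>+\<^sup>j < R\<^sup>m\<^sup>+\<^sup>1\<close>. When \<open>c\<close> is small in terms of \<open>|B\<^sub>0|\<close> and \<open>\<beta>\<close>, at most one fraction is
  then relevant for \<open>B\<^sub>m\<close> and its neighbourhood cannot meet both the left and the right quarter
  of \<open>B\<^sub>m\<close>.
\<close>

section \<open>Violations of the inequality and the fractions near them\<close>

definition bad_at :: "(nat \<Rightarrow> nat) \<Rightarrow> real \<Rightarrow> real \<Rightarrow> real \<Rightarrow> nat \<Rightarrow> real \<Rightarrow> bool" where
  "bad_at d i j c q x \<longleftrightarrow>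
     max (D_norm d q powr (1 / i)) (dist_int (real q * x) powr (1 / j)) \<le> c / real q"

text \<open>Denominators are sorted by \<open>real q powr (1 + j)\<close> because violations at
  \<open>q\<close> lie within \<open>c powr j / real q powr (1 + j)\<close> of a fraction: on level
  \<open>m\<close> these radii are at most \<open>c powr j / R ^ m\<close>, on the scale of
  \<open>B m\<close>.\<close>

definition bad_level :: "(nat \<Rightarrow> nat) \<Rightarrow> real \<Rightarrow> real \<Rightarrow> real \<Rightarrow> real \<Rightarrow> nat \<Rightarrow> real set" where
  "bad_level d i j R c m =
     {x. \<exists>q\<ge>1. R ^ m \<le> real q powr (1 + j) \<and> real q powr (1 + j) < R ^ Suc m \<and> bad_at d i j c q x}"

lemma le_powr_if_powr_inverse_le:
  fixes a b t :: real
  assumes "0 \<le> a" "0 < t" "a powr (1 / t) \<le> b"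
  shows "a \<le> b powr t"
proof -
  have "a = (a powr (1 / t)) powr t"
    using assms by (simp add: powr_powr)
  also have "\<dots> \<le> b powr t"
    using assms by (intro powr_mono2) auto
  finally show ?thesis .
qed

lemma D_prod_dvd_mono: "m \<le> n \<Longrightarrow> D_prod d m dvd D_prod d n"
  unfolding D_prod_def by (intro prod_dvd_prod_subset) auto

lemma two_power_le_D_prod:
  assumes "\<And>n. n \<ge> 1 \<Longrightarrow> d n \<ge> 2"
  shows "2 ^ n \<le> D_prod d n"
proof -
  have "(\<Prod>k=1..n. 2) \<le> (\<Prod>k=1..n. d k)"
    using assms by (intro prod_mono) auto
  then show ?thesis by (simp add: D_prod_def)
qed

text \<open>The growth of \<open>D_prod d n\<close> bounds the set of admissible \<open>n\<close>,
  so its supremum is attained.\<close>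

lemma D_prod_D_order_dvd:
  assumes d: "\<And>n. n \<ge> 1 \<Longrightarrow> d n \<ge> 2" and "q \<ge> 1"
  shows "D_prod d (D_order d q) dvd q"
proof -
  let ?S = "{n. D_prod d n dvd q}"
  have "n \<le> q" if "n \<in> ?S" for n
  proof -
    have "n < 2 ^ n" by simp
    also have "\<dots> \<le> D_prod d n" by (rule two_power_le_D_prod[OF d])
    also have "\<dots> \<le> q" using that \<open>q \<ge> 1\<close> by (auto intro: dvd_imp_le)
    finally show ?thesis by simp
  qed
  then have "finite ?S" by (meson finite_nat_set_iff_bounded_le)
  moreover have "0 \<in> ?S" by (simp add: D_prod_def)
  ultimately have "Sup ?S \<in> ?S"
    using Max_in[of ?S] by (auto simp: Sup_nat_def)
  then show ?thesis by (simp add: D_order_def)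
qed

text \<open>Exploits the first entry of the maximum; the witness is
  \<open>D_order d q\<close>.\<close>

lemma bad_at_divisor:
  assumes d: "\<And>n. n \<ge> 1 \<Longrightarrow> d n \<ge> 2" and "0 < i" "0 < c" "q \<ge> 1" and bad: "bad_at d i j c q x"
  obtains n where "D_prod d n dvd q" "(real q / c) powr i \<le> real (D_prod d n)"
proof
  let ?D = "D_prod d (D_order d q)"
  show "?D dvd q" by (rule D_prod_D_order_dvd[OF d \<open>q \<ge> 1\<close>])
  then have "?D > 0" using \<open>q \<ge> 1\<close> by (auto intro!: Nat.gr0I)
  have "1 / real ?D \<le> (c / real q) powr i"
    using bad \<open>0 < i\<close>
    by (intro le_powr_if_powr_inverse_le) (auto simp: bad_at_def D_norm_def)
  then show "(real q / c) powr i \<le> real ?D"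
    using \<open>?D > 0\<close> \<open>0 < c\<close> \<open>q \<ge> 1\<close> by (simp add: powr_divide field_simps)
qed

text \<open>Exploits the second entry of the maximum; \<open>p\<close> is the integer nearest to
  \<open>real q * x\<close>.\<close>

lemma bad_at_approx:
  assumes "0 < j" "0 < c" "q \<ge> 1" "bad_at d i j c q x"
  obtains p :: int where "\<bar>x - of_int p / real q\<bar> \<le> c powr j / real q powr (1 + j)"
proof
  have "dist_int (real q * x) \<le> (c / real q) powr j"
    using assms
    by (intro le_powr_if_powr_inverse_le) (auto simp: bad_at_def dist_int_def)
  moreover have "\<bar>x - of_int (round (real q * x)) / real q\<bar> = dist_int (real q * x) / real q"
  proof -
    have "x - of_int (round (real q * x)) / real q = (real q * x - of_int (round (real q * x))) / real q"
      using \<open>q \<ge> 1\<close> by (simp add: field_simps)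
    then show ?thesis by (simp add: dist_int_def)
  qed
  moreover have "(c / real q) powr j / real q = c powr j / real q powr (1 + j)"
    using \<open>0 < c\<close> \<open>q \<ge> 1\<close> by (simp add: powr_divide powr_add)
  ultimately show "\<bar>x - of_int (round (real q * x)) / real q\<bar> \<le> c powr j / real q powr (1 + j)"
    using \<open>q \<ge> 1\<close> by (metis divide_right_mono of_nat_0_le_iff)
qed

text \<open>The cross difference \<open>?N\<close> is a nonzero multiple of \<open>D\<close>, which
  gains a factor \<open>D\<close> over the trivial bound.\<close>

lemma fraction_separation:
  fixes p1 p2 :: int and q1 q2 D :: nat
  assumes "D dvd q1" "D dvd q2" "q1 \<ge> 1" "q2 \<ge> 1"
    and "of_int p1 / real q1 \<noteq> of_int p2 / real q2"
  shows "real D / (real q1 * real q2) \<le> \<bar>of_int p1 / real q1 - of_int p2 / real q2\<bar>"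
proof -
  let ?N = "p1 * int q2 - p2 * int q1"
  have eq: "of_int p1 / real q1 - of_int p2 / real q2 = of_int ?N / (real q1 * real q2)"
    using assms(3,4) by (simp add: field_simps)
  then have "?N \<noteq> 0" using assms(5) by force
  moreover have "int D dvd ?N" using assms(1,2) by (intro dvd_diff dvd_mult) auto
  ultimately have "int D \<le> \<bar>?N\<bar>" by (metis dvd_imp_le_int abs_of_nat)
  then have "real D \<le> \<bar>of_int ?N\<bar>" by linarith
  then have "real D / (real q1 * real q2) \<le> \<bar>of_int ?N\<bar> / (real q1 * real q2)"
    by (intro divide_right_mono) auto
  then show ?thesis unfolding eq by (simp add: abs_mult)
qed

text \<open>Both points are close to the same fraction: by \<open>small\<close>, two different ones
  would be too far apart for \<open>close\<close>. In the game \<open>L / R ^ m\<close> is the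
  length of \<open>B m\<close>.\<close>

lemma bad_level_diameter:
  assumes d: "\<And>n. n \<ge> 1 \<Longrightarrow> d n \<ge> 2" and ij: "0 < i" "0 < j" "i + j = 1"
    and c: "0 < c" and R: "0 < R"
    and x: "x1 \<in> bad_level d i j R c m" "x2 \<in> bad_level d i j R c m"
    and close: "\<bar>x1 - x2\<bar> \<le> L / R ^ m"
    and small: "R * (L + 2 * c powr j) \<le> c powr - i"
  shows "\<bar>x1 - x2\<bar> \<le> 2 * c powr j / R ^ m"
proof -
  obtain q1 where q1: "q1 \<ge> 1" "R ^ m \<le> real q1 powr (1 + j)" "real q1 powr (1 + j) < R ^ Suc m"
      "bad_at d i j c q1 x1"
    using x by (auto simp: bad_level_def)
  obtain q2 where q2: "q2 \<ge> 1" "R ^ m \<le> real q2 powr (1 + j)" "real q2 powr (1 + j) < R ^ Suc m"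
      "bad_at d i j c q2 x2"
    using x by (auto simp: bad_level_def)
  obtain p1 where p1: "\<bar>x1 - of_int p1 / real q1\<bar> \<le> c powr j / real q1 powr (1 + j)"
    using bad_at_approx[OF ij(2) c q1(1,4)] .
  obtain p2 where p2: "\<bar>x2 - of_int p2 / real q2\<bar> \<le> c powr j / real q2 powr (1 + j)"
    using bad_at_approx[OF ij(2) c q2(1,4)] .
  let ?r1 = "of_int p1 / real q1" and ?r2 = "of_int p2 / real q2"
  have "c powr j / real q1 powr (1 + j) \<le> c powr j / R ^ m"
    using q1 R by (intro divide_left_mono) auto
  then have r1: "\<bar>x1 - ?r1\<bar> \<le> c powr j / R ^ m" using p1 by simp
  have "c powr j / real q2 powr (1 + j) \<le> c powr j / R ^ m"
    using q2 R by (intro divide_left_mono) auto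
  then have r2: "\<bar>x2 - ?r2\<bar> \<le> c powr j / R ^ m" using p2 by simp
  have "?r1 = ?r2"
  proof (rule ccontr)
    assume ne: "?r1 \<noteq> ?r2"
    obtain n1 where n1: "D_prod d n1 dvd q1" "(real q1 / c) powr i \<le> real (D_prod d n1)"
      using bad_at_divisor[OF d ij(1) c q1(1,4)] by blast
    obtain n2 where n2: "D_prod d n2 dvd q2" "(real q2 / c) powr i \<le> real (D_prod d n2)"
      using bad_at_divisor[OF d ij(1) c q2(1,4)] by blast
    \<comment> \<open>The smaller denominator bounds the common divisor \<open>?D\<close> from
      below, the larger one is compared with \<open>R ^ Suc m\<close>.\<close>
    define a b where "a = real (min q1 q2)" and "b = real (max q1 q2)"
    have ab: "0 < a" "a \<le> b" "a * b = real q1 * real q2"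
      using q1(1) q2(1) by (auto simp: a_def b_def min_def max_def)
    let ?D = "D_prod d (min n1 n2)"
    have "(a / c) powr i \<le> (real q1 / c) powr i" "(a / c) powr i \<le> (real q2 / c) powr i"
      using ab c ij(1) by (auto intro!: powr_mono2 divide_right_mono simp: a_def)
    then have aD: "(a / c) powr i \<le> real ?D"
      using n1(2) n2(2) by (auto simp: min_def)
    have D: "?D dvd q1" "?D dvd q2"
      using n1(1) n2(1) D_prod_dvd_mono[of "min n1 n2"] by (meson dvd_trans min.cobounded1 min.cobounded2)+
    \<comment> \<open>Since \<open>i + j = 1\<close>, the separation bound
      \<open>(a / c) powr i / (a * b)\<close> equals \<open>c powr - i * a powr - j / b\<close>,
      which is smallest when \<open>a\<close> grows to \<open>b\<close>.\<close>
    have "c powr - i / b powr (1 + j) = c powr - i * (b powr - j / b)"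
      using ab by (simp add: powr_add powr_minus field_simps)
    also have "\<dots> \<le> c powr - i * (a powr - j / b)"
      using ab ij by (intro mult_left_mono divide_right_mono powr_mono2') auto
    also have "a powr - j = a powr i / a"
    proof -
      have "- j = i - 1" using ij by simp
      then show ?thesis using ab by (simp only: powr_diff powr_one)
    qed
    also have "c powr - i * (a powr i / a / b) = (a / c) powr i / (real q1 * real q2)"
      using ab c by (simp add: powr_divide powr_minus field_simps)
    also have "\<dots> \<le> real ?D / (real q1 * real q2)"
      using aD by (intro divide_right_mono) auto
    also have "\<dots> \<le> \<bar>?r1 - ?r2\<bar>"
      by (rule fraction_separation[OF D q1(1) q2(1) ne])
    also have "\<dots> \<le> L / R ^ m + 2 * (c powr j / R ^ m)"
      using r1 r2 close by linarith
    also have "\<dots> = R * (L + 2 * c powr j) / R ^ Suc m"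
      using R by (simp add: field_simps)
    also have "\<dots> \<le> c powr - i / R ^ Suc m"
      using small R by (intro divide_right_mono) auto
    \<comment> \<open>The strict upper end of the level closes the cycle of inequalities.\<close>
    also have "\<dots> < c powr - i / b powr (1 + j)"
      using q1 q2 ab R c
      by (intro divide_strict_left_mono) (auto simp: b_def max_def)
    finally show False by simp
  qed
  then show ?thesis using r1 r2 by linarith
qed

section \<open>Choice of the constant\<close>

definition game_const :: "real \<Rightarrow> real \<Rightarrow> real \<Rightarrow> real \<Rightarrow> real" where
  "game_const i j R L = min ((L / 5) powr (1 / j)) ((1 / (2 * R * L)) powr (1 / i))"

text \<open>The first entry of the minimum gives \<open>c powr j \<le> L / 5\<close>, whence the
  strict bound and \<open>L + 2 * c powr j \<le> 2 * L\<close>; the second is what the last claim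
  then requires.\<close>

lemma game_const:
  assumes "0 < i" "0 < j" "0 < R" "0 < L"
  defines "c \<equiv> game_const i j R L"
  shows "0 < c" "4 * c powr j < L" "R * (L + 2 * c powr j) \<le> c powr - i"
proof -
  show c: "0 < c" using assms by (simp add: game_const_def)
  have "c powr j \<le> ((L / 5) powr (1 / j)) powr j"
    using assms c by (intro powr_mono2) (auto simp: game_const_def)
  then have cj: "c powr j \<le> L / 5" using assms by (simp add: powr_powr)
  then show "4 * c powr j < L" using \<open>0 < L\<close> by simp
  have "c powr i \<le> ((1 / (2 * R * L)) powr (1 / i)) powr i"
    using assms c by (intro powr_mono2) (auto simp: game_const_def)
  then have ci: "c powr i \<le> 1 / (2 * R * L)" using assms by (simp add: powr_powr)
  have "R * (L + 2 * c powr j) \<le> R * (2 * L)"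
    using cj assms by (intro mult_left_mono) auto
  also have "\<dots> \<le> 1 / c powr i"
    using ci assms c by (simp add: field_simps)
  finally show "R * (L + 2 * c powr j) \<le> c powr - i"
    by (simp add: powr_minus_divide)
qed

section \<open>The move of player A\<close>

definition avoid_quarter :: "real set \<Rightarrow> real set \<Rightarrow> real set" where
  "avoid_quarter X I =
     (let a = Inf I; b = Sup I; J = {a..a + (b - a) / 4} in
      if J \<inter> X = {} then J else {b - (b - a) / 4..b})"

lemma legal_move_avoid_quarter:
  assumes "closed_interval I"
  shows "legal_move (1 / 4) I (avoid_quarter X I)"
proof -
  obtain a b where ab: "a < b" "I = {a..b}"
    using assms by (auto simp: closed_interval_def)
  let ?l = "(b - a) / 4"
  have l: "a < a + ?l" "b - ?l < b" "a + ?l \<le> b" "a \<le> b - ?l"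
    using ab(1) by (auto simp: field_simps)
  then have "closed_interval {a..a + ?l}" "closed_interval {b - ?l..b}"
    unfolding closed_interval_def by blast+
  then show ?thesis
    using ab l by (simp add: legal_move_def avoid_quarter_def Let_def)
qed

text \<open>Points of the left and the right quarter are at least \<open>(b - a) / 2\<close> apart,
  so \<open>X\<close> cannot meet both.\<close>

lemma avoid_quarter_disjoint:
  assumes "a < b"
    and "\<And>x y. x \<in> X \<Longrightarrow> y \<in> X \<Longrightarrow> x \<in> {a..b} \<Longrightarrow> y \<in> {a..b} \<Longrightarrow> \<bar>x - y\<bar> < (b - a) / 2"
  shows "avoid_quarter X {a..b} \<inter> X = {}"
proof (cases "{a..a + (b - a) / 4} \<inter> X = {}")
  case True
  then show ?thesis using assms(1) by (simp add: avoid_quarter_def)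
next
  case False
  then obtain x where x: "x \<in> X" "a \<le> x" "x \<le> a + (b - a) / 4" by auto
  have "y \<notin> X" if "b - (b - a) / 4 \<le> y" "y \<le> b" for y
    using assms(2)[of x y] x that assms(1) by (auto simp: abs_if field_simps split: if_splits)
  then show ?thesis using False assms(1) by (auto simp: avoid_quarter_def)
qed

section \<open>From levels to the target set, and limits of plays\<close>

lemma power_level_exists:
  fixes R y :: real
  assumes "1 < R" "1 \<le> y"
  obtains m where "R ^ m \<le> y" "y < R ^ Suc m"
proof -
  obtain n where n: "y < R ^ n" using real_arch_pow[OF assms(1)] by blast
  define k where "k = (LEAST n. y < R ^ n)"
  have k: "y < R ^ k" unfolding k_def by (rule LeastI[of "\<lambda>n. y < R ^ n", OF n])
  then obtain m where m: "k = Suc m" using assms(2) by (cases k) auto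
  have "R ^ m \<le> y" using not_less_Least[of m "\<lambda>n. y < R ^ n"] m by (simp add: k_def not_less)
  then show ?thesis using that k m by blast
qed

text \<open>As \<open>real q powr (1 + j)\<close> is at least 1, every denominator belongs to some
  level, so one constant \<open>c\<close> serves all \<open>q\<close>.\<close>

lemma mem_Bad_D_if_no_bad_level:
  assumes "1 < R" "0 < j" "0 < c" and "\<And>m. x \<notin> bad_level d i j R c m"
  shows "x \<in> Bad_D d i j"
proof -
  have "c / real q < max (D_norm d q powr (1 / i)) (dist_int (real q * x) powr (1 / j))"
    if "q \<ge> 1" for q
  proof -
    have "1 \<le> real q powr (1 + j)"
      using that assms(2) by (intro ge_one_powr_ge_zero) auto
    then obtain m where "R ^ m \<le> real q powr (1 + j)" "real q powr (1 + j) < R ^ Suc m"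
      using power_level_exists[OF assms(1)] by blast
    then have "\<not> bad_at d i j c q x"
      using assms(4)[of m] that by (auto simp: bad_level_def)
    then show ?thesis unfolding bad_at_def not_le .
  qed
  then show ?thesis using assms(3) by (auto simp: Bad_D_def)
qed

lemma play_interval:
  assumes "strategy \<alpha> \<sigma>" "play_against \<beta> \<sigma> B"
  shows "closed_interval (B m) \<and> reply \<sigma> B m \<subseteq> B m \<and> B (Suc m) \<subseteq> reply \<sigma> B m \<and>
         measure lborel (B m) = (\<alpha> * \<beta>) ^ m * measure lborel (B 0)"
proof -
  have B: "closed_interval (B m)" for m
    using assms(2) by (cases m) (auto simp: play_against_def legal_move_def)
  have step: "legal_move \<beta> (reply \<sigma> B m) (B (Suc m))" for m
    using assms(2) by (simp add: play_against_def)
  have rep: "legal_move \<alpha> (B m) (reply \<sigma> B m)" for m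
    using assms(1)[unfolded strategy_def, rule_format, of "map B [0..<Suc m]"] B[of m]
    by (simp add: reply_def)
  have "measure lborel (B m) = (\<alpha> * \<beta>) ^ m * measure lborel (B 0)"
  proof (induction m)
    case (Suc m)
    then show ?case using step[of m] rep[of m] by (simp add: legal_move_def)
  qed simp
  then show ?thesis using B step[of m] rep[of m] by (simp add: legal_move_def)
qed

text \<open>Nested closed intervals with lengths tending to 0; the limit lies in each reply because
  \<open>B (Suc m)\<close> does.\<close>

lemma play_limit_point:
  assumes "strategy \<alpha> \<sigma>" "play_against \<beta> \<sigma> B" "0 \<le> \<alpha> * \<beta>" "\<alpha> * \<beta> < 1"
  obtains x where "(\<Inter>m. B m) = {x}" "\<And>m. x \<in> reply \<sigma> B m"
proof -
  note P = play_interval[OF assms(1,2)]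
  have "\<exists>a. \<Inter>(range B) = {a}"
  proof (rule decreasing_closed_nest_sing)
    show "closed (B n)" "B n \<noteq> {}" for n
      using P[of n] by (auto simp: closed_interval_def)
    show "B n \<subseteq> B m" if "m \<le> n" for m n
      using lift_Suc_antimono_le[of B, OF _ that] P by blast
    fix e :: real assume "e > 0"
    have "(\<lambda>n. (\<alpha> * \<beta>) ^ n * measure lborel (B 0)) \<longlonglongrightarrow> 0 * measure lborel (B 0)"
      using assms(3,4) by (intro tendsto_mult LIMSEQ_realpow_zero tendsto_const)
    then have "eventually (\<lambda>n. (\<alpha> * \<beta>) ^ n * measure lborel (B 0) < e) sequentially"
      using \<open>e > 0\<close> by (intro order_tendstoD(2)) auto
    then obtain n where "(\<alpha> * \<beta>) ^ n * measure lborel (B 0) < e"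
      by (meson eventually_sequentially order_refl)
    then have "measure lborel (B n) < e" using P[of n] by metis
    moreover obtain a b where "a < b" "B n = {a..b}"
      using P[of n] by (auto simp: closed_interval_def)
    ultimately have "\<forall>x\<in>B n. \<forall>y\<in>B n. dist x y < e"
      by (auto simp: dist_real_def)
    then show "\<exists>n. \<forall>x\<in>B n. \<forall>y\<in>B n. dist x y < e" ..
  qed
  then obtain x where x: "\<Inter>(range B) = {x}" by blast
  have "x \<in> B (Suc m)" for m using x by blast
  then have "x \<in> reply \<sigma> B m" for m using P by blast
  with x show ?thesis using that by blast
qed

theorem theorem1:
  fixes d :: "nat \<Rightarrow> nat" and i j :: real
  assumes "\<And>n. n \<ge> 1 \<Longrightarrow> d n \<ge> 2"
    and "bdd_above (d ` {1..})"
    and "0 < i" and "i < 1" and "0 < j" and "j < 1" and "i + j = 1"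
  shows "winning (1 / 4) (Bad_D d i j)"
  unfolding winning_def winning2_def
proof (intro allI impI)
  fix \<beta> :: real assume \<beta>: "0 < \<beta> \<and> \<beta> < 1"
  define R where "R = 4 / \<beta>"
  have R: "1 < R" using \<beta> by (simp add: R_def)
  \<comment> \<open>The constant depends on the first interval of B, hence \<open>hd Bs\<close>. At
    move \<open>m\<close> the list has \<open>m + 1\<close> entries, hence
    \<open>length Bs - 1\<close>.\<close>
  define \<sigma> where "\<sigma> Bs = avoid_quarter (bad_level d i j R
      (game_const i j R (measure lborel (hd Bs))) (length Bs - 1)) (last Bs)" for Bs
  have \<sigma>: "strategy (1 / 4) \<sigma>"
    by (auto simp: strategy_def \<sigma>_def intro: legal_move_avoid_quarter)
  moreover have "\<exists>x\<in>Bad_D d i j. (\<Inter>m. B m) = {x}" if B: "play_against \<beta> \<sigma> B" for B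
  proof -
    note P = play_interval[OF \<sigma> B]
    define L c where "L = measure lborel (B 0)" and "c = game_const i j R L"
    have "0 < L" using P[of 0] by (auto simp: L_def closed_interval_def)
    then have c: "0 < c" "4 * c powr j < L" "R * (L + 2 * c powr j) \<le> c powr - i"
      using game_const[of i j R L] assms(3,5) R by (simp_all add: c_def)
    have reply: "reply \<sigma> B m = avoid_quarter (bad_level d i j R c m) (B m)" for m
    proof -
      have "hd (map B [0..<Suc m]) = B 0" by (simp add: hd_map del: upt_Suc)
      moreover have "last (map B [0..<Suc m]) = B m" by simp
      moreover have "length (map B [0..<Suc m]) - 1 = m" by simp
      ultimately show ?thesis by (simp only: reply_def \<sigma>_def c_def L_def)
    qed
    have disj: "reply \<sigma> B m \<inter> bad_level d i j R c m = {}" for m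
    proof -
      obtain a b where ab: "a < b" "B m = {a..b}"
        using P[of m] by (auto simp: closed_interval_def)
      have "(1 / 4 * \<beta>) ^ m = 1 / R ^ m"
        by (simp add: R_def power_divide power_mult_distrib)
      then have len: "b - a = L / R ^ m"
        using P[of m] ab by (simp add: L_def)
      show ?thesis unfolding reply ab(2)
      proof (rule avoid_quarter_disjoint[OF ab(1)])
        fix x y assume xy: "x \<in> bad_level d i j R c m" "y \<in> bad_level d i j R c m"
          "x \<in> {a..b}" "y \<in> {a..b}"
        then have "\<bar>x - y\<bar> \<le> L / R ^ m" using len by auto
        then have "\<bar>x - y\<bar> \<le> 2 * c powr j / R ^ m"
          using bad_level_diameter[OF assms(1,3,5,7) c(1) _ xy(1,2) _ c(3)] R by simp
        \<comment> \<open>This is \<open>4 * c powr j < L\<close>.\<close>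
        also have "\<dots> < (L / 2) / R ^ m"
          using c R by (intro divide_strict_right_mono) auto
        finally show "\<bar>x - y\<bar> < (b - a) / 2" by (simp add: len)
      qed
    qed
    obtain x where x: "(\<Inter>m. B m) = {x}" "\<And>m. x \<in> reply \<sigma> B m"
      using play_limit_point[OF \<sigma> B] \<beta> by auto
    have "x \<in> Bad_D d i j"
      using x(2) disj by (intro mem_Bad_D_if_no_bad_level[OF R assms(5) c(1)]) blast
    then show ?thesis using x(1) by blast
  qed
  ultimately show "\<exists>\<sigma>. strategy (1 / 4) \<sigma> \<and>
      (\<forall>B. play_against \<beta> \<sigma> B \<longrightarrow> (\<exists>x\<in>Bad_D d i j. (\<Inter>m. B m) = {x}))"
    by blast
qed

end
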